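(* Let $0<q<1$ and let $E_{n,q}(x)$, $E_{n,q}$ and $E^{(r)}_{k,q}(x)$ be as defined in the context. Then for all integers $n,r \geq 0$, $$E_{n,q}(x)=\frac{1}{2^r}\sum_{k=0}^{n} \Bigg\{ \sum_{m=0}^{n-k}\sum_{l=0}^{r} \sum_{\substack{i_1+ \cdots +i_l=m\\ i_1,\dots,i_l\ge0}}\binom{r}{l}\binom{m}{i_1, \cdots , i_l}_q \binom{m+k}{m}_q \binom{n}{m+k}_q E_{n-m-k,q} \Bigg\} E_{k,q}^{(r)}(x),$$ where $\binom{m}{i_1, \cdots , i_l}_q=\frac{[m]_q!}{[i_1]_q!\cdots[i_l]_q!}$.
   Context: Fix a real number $q$ with $0<q<1$. For an integer $n\ge 0$ set $[n]_q=\frac{1-q^n}{1-q}$, $[0]_q!=1$, $[n]_q!=[1]_q\cdots[n]_q$, and $\binom{n}{k}_q=\frac{[n]_q!}{[k]_q![n-k]_q!}$ for $0\le k\le n$. Let $e_q(z)=\sum_{n=0}^{\infty}\frac{z^n}{[n]_q!}$. The $q$-Euler polynomials are defined by $\frac{2}{e_q(t)+1}e_q(xt)=\sum_{n\ge0}E_{n,q}(x)\frac{t^n}{[n]_q!}$, with $E_{n,q}=E_{n,q}(0)$. For an integer $r\ge0$, the $q$-Euler polynomials of order $r$ are defined by $\left(\frac{2}{e_q(t)+1}\right)^r e_q(xt)=\sum_{n\ge0}E^{(r)}_{n,q}(x)\frac{t^n}{[n]_q!}$. For $l=0$ the sum over $i_1+\cdots+i_0=m$ is understood as $1$ if $m=0$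 and $0$ otherwise. *)

theory Defs
  imports Complex_Main "HOL-Computational_Algebra.Formal_Power_Series"
begin

definition qint :: "real \<Rightarrow> nat \<Rightarrow> real" where
  "qint q n = (1 - q ^ n) / (1 - q)"

definition qfact :: "real \<Rightarrow> nat \<Rightarrow> real" where
  "qfact q n = (\<Prod>j=1..n. qint q j)"

text \<open>Meant for \<open>k \<le> n\<close> only: truncated subtraction makes the value meaningless otherwise.\<close>

definition qbinomial :: "real \<Rightarrow> nat \<Rightarrow> nat \<Rightarrow> real" where
  "qbinomial q n k = qfact q n / (qfact q k * qfact q (n - k))"

definition qmultinomial :: "real \<Rightarrow> nat \<Rightarrow> nat list \<Rightarrow> real" where
  "qmultinomial q m is = qfact q m / (\<Prod>i\<leftarrow>is. qfact q i)"

text \<open>All generating functions are formal power series in \<open>t = fps_X\<close>. The constant term of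
  \<open>qexp q + 1\<close> is \<open>2\<close>, so the quotients below are by units.\<close>

definition qexp :: "real \<Rightarrow> real fps" where
  "qexp q = Abs_fps (\<lambda>n. 1 / qfact q n)"

definition qEuler :: "real \<Rightarrow> nat \<Rightarrow> real \<Rightarrow> real" where
  "qEuler q n x =
     qfact q n * fps_nth (2 / (qexp q + 1) * (qexp q oo (fps_const x * fps_X))) n"

definition qEuler_order :: "real \<Rightarrow> nat \<Rightarrow> nat \<Rightarrow> real \<Rightarrow> real" where
  "qEuler_order q r n x =
     qfact q n * fps_nth ((2 / (qexp q + 1)) ^ r * (qexp q oo (fps_const x * fps_X))) n"

abbreviation qEuler_number :: "real \<Rightarrow> nat \<Rightarrow> real" where
  "qEuler_number q n \<equiv> qEuler q n 0"

text \<open>\<open>compositions l m\<close> is the set of tuples \<open>(i\<^sub>1, \<dots>, i\<^sub>l)\<close> of natural numbers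
  with sum \<open>m\<close>; zero entries are allowed, and for \<open>l = 0\<close> the only candidate is the empty tuple.\<close>

definition compositions :: "nat \<Rightarrow> nat \<Rightarrow> nat list set" where
  "compositions l m = {is. length is = l \<and> sum_list is = m}"

lemma finite_compositions: "finite (compositions l m)"
proof (rule finite_subset)
  show "compositions l m \<subseteq> {is. set is \<subseteq> {..m} \<and> length is = l}"
    by (auto simp: compositions_def intro: member_le_sum_list)
  show "finite {is. set is \<subseteq> {..m} \<and> length is = l}"
    by (rule finite_lists_length_eq) simp
qed

lemma qfact_nonzero:
  assumes "0 < q" "q < 1"
  shows "qfact q n \<noteq> 0"
proof -
  have "q ^ j \<noteq> 1" if "j \<ge> 1" for j
    using power_strict_decreasing[of 0 j q] assms that by simp
  then show ?thesis
    using assms by (auto simp: qfact_def qint_def)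
qed

lemma qEuler_generating_function:
  assumes "0 < q" "q < 1"
  shows "2 / (qexp q + 1) * (qexp q oo (fps_const x * fps_X)) =
    Abs_fps (\<lambda>n. qEuler q n x / qfact q n)"
  using qfact_nonzero[OF assms] by (simp add: fps_eq_iff qEuler_def)

lemma qEuler_order_generating_function:
  assumes "0 < q" "q < 1"
  shows "(2 / (qexp q + 1)) ^ r * (qexp q oo (fps_const x * fps_X)) =
    Abs_fps (\<lambda>n. qEuler_order q r n x / qfact q n)"
  using qfact_nonzero[OF assms] by (simp add: fps_eq_iff qEuler_order_def)

end

theory Submission
  imports Defs
begin

text \<open>Write \<open>e = qexp q\<close>, \<open>G = 2 / (e + 1)\<close> and \<open>F = qexp q oo (fps_const x * fps_X)\<close>. Since
  \<open>G * (e + 1) = 2\<close>, we have \<open>G * F = ((e + 1) ^ r * G) * (G ^ r * F) / 2 ^ r\<close>. The identity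
  compares coefficients of \<open>t ^ n\<close>, after expanding \<open>(e + 1) ^ r\<close> by the binomial theorem and
  each \<open>e ^ l\<close> as a sum over compositions.\<close>

text \<open>This is the Cauchy product of \<open>l\<close> equal factors: entry \<open>i\<close> of
  a composition records which coefficient the corresponding factor contributes.\<close>

lemma fps_power_nth_compositions:
  fixes f :: "real fps"
  shows "fps_nth (f ^ l) m = (\<Sum>is\<in>compositions l m. \<Prod>i\<leftarrow>is. fps_nth f i)"
proof -
  have eq: "compositions l m = natpermute m l" for l m
    by (auto simp: compositions_def natpermute_def)
  show ?thesis
  \<comment> \<open>The positions of a tuple form \<open>{0..l - 1}\<close> only for
    \<open>l > 0\<close>, so the empty tuple is treated apart.\<close>
  proof (cases l)
    case 0
    then have "compositions l m = (if m = 0 then {[]} else {})"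
      by (auto simp: compositions_def)
    then show ?thesis
      using 0 by simp
  next
    case (Suc j)
    have "(\<Prod>i\<in>{0..j}. fps_nth f (is ! i)) = (\<Prod>i\<leftarrow>is. fps_nth f i)"
      if "is \<in> compositions l m" for "is"
      using that Suc
      by (simp add: compositions_def prod.list_conv_set_nth atLeast0AtMost lessThan_Suc_atMost
          atLeast0LessThan)
    then have "(\<Sum>is\<in>compositions l m. \<Prod>i\<in>{0..j}. fps_nth f (is ! i))
        = (\<Sum>is\<in>compositions l m. \<Prod>i\<leftarrow>is. fps_nth f i)"
      by (rule sum.cong[OF refl])
    then show ?thesis
      using Suc by (simp add: fps_power_nth eq del: power_Suc)
  qed
qed

lemma qexp_nth_prod_list:
  "(\<Prod>i\<leftarrow>is. fps_nth (qexp q) i) = 1 / (\<Prod>i\<leftarrow>is. qfact q i)"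
  by (induction "is") (simp_all add: qexp_def)

lemma qexp_plus_one_power_nth:
  "fps_nth ((qexp q + 1) ^ r) m =
    (\<Sum>l=0..r. \<Sum>is\<in>compositions l m. real (r choose l) / (\<Prod>i\<leftarrow>is. qfact q i))"
proof -
  have "(qexp q + 1) ^ r = (\<Sum>l=0..r. fps_const (real (r choose l)) * qexp q ^ l)"
    by (simp add: binomial_ring atLeast0AtMost fps_of_nat)
  then show ?thesis
    by (simp add: fps_sum_nth fps_power_nth_compositions qexp_nth_prod_list sum_distrib_left)
qed

text \<open>At \<open>x = 0\<close> the factor \<open>qexp q oo 0\<close> collapses to its constant
  term, which is 1.\<close>

lemma qEuler_number_eq: "qEuler_number q n = qfact q n * fps_nth (2 / (qexp q + 1)) n"
  by (simp add: qEuler_def fps_compose_0_right qexp_def qfact_def)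

lemma qEuler_series_eq_order_product:
  "2 / (qexp q + 1) * F =
    fps_const (1 / 2 ^ r) * (((qexp q + 1) ^ r * (2 / (qexp q + 1))) * ((2 / (qexp q + 1)) ^ r * F))"
proof -
  let ?G = "2 / (qexp q + 1)"
  \<comment> \<open>The constant term is 2, so the quotient is a genuine product with an
    inverse.\<close>
  have unit: "fps_nth (qexp q + 1) 0 \<noteq> 0"
    by (simp add: qexp_def qfact_def)
  have "?G * (qexp q + 1) = 2"
    using unit by (simp add: fps_divide_unit mult.assoc inverse_mult_eq_1)
  then have "(qexp q + 1) ^ r * ?G ^ r = 2 ^ r"
    unfolding power_mult_distrib[symmetric] by (simp only: mult.commute)
  also have "\<dots> = fps_const (2 ^ r)"
    by (simp add: numeral_fps_const)
  finally have "fps_const (1 / 2 ^ r) * ((qexp q + 1) ^ r * ?G ^ r) = 1"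
    by (simp only: fps_const_mult) simp
  then have "?G * F = fps_const (1 / 2 ^ r) * ((qexp q + 1) ^ r * ?G ^ r) * (?G * F)"
    by (simp only: mult_1)
  then show ?thesis
    by (simp only: mult_ac)
qed

theorem theorem8:
  fixes q x :: real and n r :: nat
  assumes "0 < q" and "q < 1"
  shows "qEuler q n x =
    1 / 2 ^ r * (\<Sum>k=0..n.
      (\<Sum>m=0..n - k. \<Sum>l=0..r. \<Sum>is\<in>compositions l m.
        real (r choose l) * qmultinomial q m is * qbinomial q (m + k) m
          * qbinomial q n (m + k) * qEuler_number q (n - m - k))
      * qEuler_order q r k x)"
proof -
  define G where "G = 2 / (qexp q + 1)"
  define F where "F = qexp q oo (fps_const x * fps_X)"
  note nz = qfact_nonzero[OF assms]
  \<comment> \<open>The factorials of \<open>m\<close>, \<open>m + k\<close> and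
    \<open>n - m - k\<close> cancel; the surviving ratio \<open>qfact q n / qfact q k\<close>
    depends on neither \<open>m\<close>, \<open>l\<close> nor \<open>is\<close>.\<close>
  have summand: "real (r choose l) * qmultinomial q m is * qbinomial q (m + k) m
        * qbinomial q n (m + k) * qEuler_number q (n - m - k)
      = real (r choose l) / (\<Prod>i\<leftarrow>is. qfact q i) * fps_nth G (n - k - m) * (qfact q n / qfact q k)"
    for l m k "is"
  proof -
    have "n - m - k = n - k - m" "n - (m + k) = n - k - m" by simp_all
    then show ?thesis
      using nz by (simp add: qEuler_number_eq G_def qmultinomial_def qbinomial_def)
  qed
  \<comment> \<open>With that ratio pulled out, the sum over \<open>m\<close> is the Cauchy product
    of \<open>(qexp q + 1) ^ r\<close> and \<open>G\<close>.\<close>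
  have inner: "(\<Sum>m=0..n - k. \<Sum>l=0..r. \<Sum>is\<in>compositions l m.
        real (r choose l) * qmultinomial q m is * qbinomial q (m + k) m
          * qbinomial q n (m + k) * qEuler_number q (n - m - k))
      = fps_nth ((qexp q + 1) ^ r * G) (n - k) * (qfact q n / qfact q k)" for k
    unfolding summand fps_mult_nth qexp_plus_one_power_nth by (simp only: sum_distrib_right)
  have "qEuler q n x = qfact q n * fps_nth (G * F) n"
    by (simp add: qEuler_def G_def F_def)
  \<comment> \<open>\<open>G ^ r * F\<close> is put first so that the Cauchy index \<open>k\<close>
    falls on it; its coefficient at \<open>k\<close> is
    \<open>qEuler_order q r k x / qfact q k\<close>.\<close>
  also have "fps_nth (G * F) n = 1 / 2 ^ r * fps_nth ((G ^ r * F) * ((qexp q + 1) ^ r * G)) n"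
    unfolding G_def
    by (subst qEuler_series_eq_order_product[where r = r]) (simp add: mult.commute)
  also have "qfact q n * \<dots> = 1 / 2 ^ r * (\<Sum>k=0..n.
      fps_nth ((qexp q + 1) ^ r * G) (n - k) * (qfact q n / qfact q k) * qEuler_order q r k x)"
    unfolding fps_mult_nth[of "G ^ r * F"] using nz
    by (simp add: sum_distrib_left qEuler_order_def flip: G_def F_def) (simp add: mult_ac)
  finally show ?thesis
    by (simp only: inner)
qed

end
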